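(* Assume the smoothers $R_k$ are convergent, i.e. $\|I-R_kA_k\|_{A_k}<1$ for $2\le k\le J$. Then for every $k\in\{1,\dots,J\}$ and every $v\in V_k$, $$0 \leq (v - \tilde{B}_k[A_kv], v)_{A_k} \leq (v - \hat{B}_k[A_kv], v)_{A_k} \leq (v - B_kA_kv, v)_{A_k},$$ where $B_k$ is the (linear) V-cycle multigrid operator, $\hat{B}_k[\cdot]$ is the (symmetric) nonlinear AMLI-cycle multigrid operator, and $\tilde{B}_k[\cdot]$ is given by $n\ge1$ steps of the (full) nonlinear PCG method with $\hat{B}_k[\cdot]$ as the preconditioner.
   Context: Setting. $V$ is a finite-dimensional real vector space with inner product $(\cdot,\cdot)$ and norm $\|\cdot\|$; $A:V\to V$ is symmetric positive definite (SPD) with respect to $(\cdot,\cdot)$; $(u,v)_A=(Au,v)$. $V_1\subset V_2\subset\cdots\subset V_J=V$ are nested subspaces. $Q_k,P_k:V\to V_k$ are the orthogonal projections with respect to $(\cdot,\cdot)$ and $(\cdot,\cdot)_A$. $A_k:V_k\to V_k$ is defined by $(A_ku_k,v_k)=(u_k,v_k)_A$ for $u_k,v_k\in V_k$; it is SPD, $(u,v)_{A_k}=(A_ku,v)$, with norm $\|\cdot\|_{A_k}$ (also used for the induced operator norm). $R_k:V_k\to V_k$ ($2\le k\le J$) are given linear smoothers and $R_k^t$ is the adjoint of $R_k$ with respect to $(\cdot,\cdot)$. V-cycle: $B_1=A_1^{-1}$ and, for $k\ge2$, $f\in V_k$: $u_1=R_kf$, $u_2=u_1+B_{k-1}Q_{k-1}(f-A_ku_1)$,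 $B_kf=u_2+R_k^t(f-A_ku_2)$. Nonlinear PCG ($n$ steps, full version, $n\ge1$ fixed) on $V_k$ with a given, possibly nonlinear, preconditioner $\hat B_k[\cdot]:V_k\to V_k$: for $f\in V_k$ put $u_0=0$, $r_0=f$, $p_0=\hat B_k[r_0]$; for $i=1,\dots,n-1$, $p_i=\hat B_k[r_i]+\sum_{j=0}^{i-1}\beta_{i,j}p_j$ with $\beta_{i,j}=-(\hat B_k[r_i],p_j)_{A_k}/(p_j,p_j)_{A_k}$; for $i=0,\dots,n-1$, $\alpha_i=(r_i,p_i)/(p_i,p_i)_{A_k}$, $u_{i+1}=u_i+\alpha_ip_i$, $r_{i+1}=r_i-\alpha_iA_kp_i$. The output is $\tilde B_k[f]:=u_n$. Convention: a coefficient $\alpha_i$ or $\beta_{i,j}$ whose denominator vanishes is taken to be $0$. Nonlinear AMLI-cycle: $\hat B_1[f]=A_1^{-1}f$ and, for $k\ge2$, $f\in V_k$: $u_1=R_kf$, $u_2=u_1+\tilde B_{k-1}[Q_{k-1}(f-A_ku_1)]$, $\hat B_k[f]=u_2+R_k^t(f-A_ku_2)$, where on each level $\tilde B_{j}[\cdot]$ is the operator produced by $n$ steps of nonlinear PCG on $V_{j}$ with preconditioner $\hat B_{j}[\cdot]$. *)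

theory Defs
  imports "HOL-Analysis.Analysis"
begin

text \<open>
  All spaces are subspaces of one ambient inner product space. An operator on a subspace \<open>S\<close> is a
  function on the ambient type whose values outside \<open>S\<close> are irrelevant; the operators below that are
  given by a variational identity on \<open>S\<close> are written with a definite description, which is
  well-defined for finite-dimensional \<open>S\<close> and, for \<open>adjoint_on\<close>, for \<open>T\<close> linear on \<open>S\<close>.
\<close>

definition spd :: "('a::real_inner \<Rightarrow> 'a) \<Rightarrow> bool" where
  "spd A \<longleftrightarrow> linear A \<and> (\<forall>u v. A u \<bullet> v = u \<bullet> A v) \<and> (\<forall>u. u \<noteq> 0 \<longrightarrow> 0 < A u \<bullet> u)"

definition linear_self_map_on :: "'a::real_vector set \<Rightarrow> ('a \<Rightarrow> 'a) \<Rightarrow> bool" where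
  "linear_self_map_on S T \<longleftrightarrow> T ` S \<subseteq> S \<and>
     (\<forall>u\<in>S. \<forall>v\<in>S. T (u + v) = T u + T v) \<and> (\<forall>c. \<forall>u\<in>S. T (c *\<^sub>R u) = c *\<^sub>R T u)"

definition a_inner :: "('a::real_inner \<Rightarrow> 'a) \<Rightarrow> 'a \<Rightarrow> 'a \<Rightarrow> real" where
  "a_inner A u v = A u \<bullet> v"

definition a_norm :: "('a::real_inner \<Rightarrow> 'a) \<Rightarrow> 'a \<Rightarrow> real" where
  "a_norm A u = sqrt (a_inner A u u)"

text \<open>As for \<^const>\<open>onorm\<close>, the vector \<open>0\<close> contributes the quotient \<open>0 / 0 = 0\<close>, so the supremum is
  over a nonempty set also when \<open>S = {0}\<close>.\<close>

definition a_opnorm_on :: "'a::real_inner set \<Rightarrow> ('a \<Rightarrow> 'a) \<Rightarrow> ('a \<Rightarrow> 'a) \<Rightarrow> real" where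
  "a_opnorm_on S A T = (SUP u\<in>S. a_norm A (T u) / a_norm A u)"

definition orth_proj :: "'a::real_inner set \<Rightarrow> 'a \<Rightarrow> 'a" where
  "orth_proj S x = (THE y. y \<in> S \<and> (\<forall>w\<in>S. (x - y) \<bullet> w = 0))"

definition level_op :: "('a::real_inner \<Rightarrow> 'a) \<Rightarrow> 'a set \<Rightarrow> 'a \<Rightarrow> 'a" where
  "level_op A S u = (THE w. w \<in> S \<and> (\<forall>v\<in>S. w \<bullet> v = a_inner A u v))"

definition adjoint_on :: "'a::real_inner set \<Rightarrow> ('a \<Rightarrow> 'a) \<Rightarrow> 'a \<Rightarrow> 'a" where
  "adjoint_on S T v = (THE w. w \<in> S \<and> (\<forall>u\<in>S. T u \<bullet> v = u \<bullet> w))"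

text \<open>The symmetric two-level step shared by both cycles: pre-smoothing with \<open>R\<close> on \<open>S\<close>,
  correction by \<open>C\<close> (an operator on the coarse space \<open>S'\<close>, possibly nonlinear), post-smoothing
  with the adjoint of \<open>R\<close>. The argument \<open>M\<close> is the operator on the level \<open>S\<close>.\<close>

definition cycle_step ::
  "'a::real_inner set \<Rightarrow> 'a set \<Rightarrow> ('a \<Rightarrow> 'a) \<Rightarrow> ('a \<Rightarrow> 'a) \<Rightarrow> ('a \<Rightarrow> 'a) \<Rightarrow> 'a \<Rightarrow> 'a" where
  "cycle_step S' S M R C f =
     (let u1 = R f;
          u2 = u1 + C (orth_proj S' (f - M u1))
      in u2 + adjoint_on S R (f - M u2))"

text \<open>Levels are numbered from \<open>1\<close>; the value at level \<open>0\<close> is arbitrary.\<close>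

fun vcycle :: "('a::real_inner \<Rightarrow> 'a) \<Rightarrow> (nat \<Rightarrow> 'a set) \<Rightarrow> (nat \<Rightarrow> 'a \<Rightarrow> 'a) \<Rightarrow> nat \<Rightarrow> 'a \<Rightarrow> 'a" where
  "vcycle A V R 0 = (\<lambda>f. 0)"
| "vcycle A V R (Suc 0) = inv_into (V 1) (level_op A (V 1))"
| "vcycle A V R (Suc (Suc k)) =
     cycle_step (V (Suc k)) (V (Suc (Suc k))) (level_op A (V (Suc (Suc k)))) (R (Suc (Suc k)))
       (vcycle A V R (Suc k))"

text \<open>Full nonlinear PCG for the operator \<open>M\<close>, the preconditioner \<open>B\<close> and the right-hand side \<open>f\<close>:
  \<open>pcg_r\<close>, \<open>pcg_p\<close> and \<open>pcg_u\<close> are the residuals, search directions and iterates. Since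
  \<open>x / 0 = 0\<close>, coefficients with vanishing denominator are \<open>0\<close>.\<close>

function (sequential)
  pcg_r :: "('a::real_inner \<Rightarrow> 'a) \<Rightarrow> ('a \<Rightarrow> 'a) \<Rightarrow> 'a \<Rightarrow> nat \<Rightarrow> 'a" and
  pcg_p :: "('a::real_inner \<Rightarrow> 'a) \<Rightarrow> ('a \<Rightarrow> 'a) \<Rightarrow> 'a \<Rightarrow> nat \<Rightarrow> 'a"
where
  "pcg_r M B f 0 = f"
| "pcg_r M B f (Suc i) = pcg_r M B f i
     - ((pcg_r M B f i \<bullet> pcg_p M B f i) / a_inner M (pcg_p M B f i) (pcg_p M B f i))
         *\<^sub>R M (pcg_p M B f i)"
| "pcg_p M B f i = B (pcg_r M B f i)
     + (\<Sum>j<i. (- a_inner M (B (pcg_r M B f i)) (pcg_p M B f j)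
                / a_inner M (pcg_p M B f j) (pcg_p M B f j)) *\<^sub>R pcg_p M B f j)"
  by pat_completeness auto
termination
  by (relation "Wellfounded.measure (\<lambda>x. case x of Inl (M, B, f, i) \<Rightarrow> 2 * i
                                           | Inr (M, B, f, i) \<Rightarrow> 2 * i + 1)")
    auto

text \<open>As a rewrite rule, the equation for \<open>pcg_p\<close> would unfold forever under the sum.\<close>

declare pcg_p.simps [simp del]

fun pcg_u :: "('a::real_inner \<Rightarrow> 'a) \<Rightarrow> ('a \<Rightarrow> 'a) \<Rightarrow> 'a \<Rightarrow> nat \<Rightarrow> 'a" where
  "pcg_u M B f 0 = 0"
| "pcg_u M B f (Suc i) = pcg_u M B f i
     + ((pcg_r M B f i \<bullet> pcg_p M B f i) / a_inner M (pcg_p M B f i) (pcg_p M B f i))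
         *\<^sub>R pcg_p M B f i"

definition nonlinear_pcg ::
  "nat \<Rightarrow> ('a::real_inner \<Rightarrow> 'a) \<Rightarrow> ('a \<Rightarrow> 'a) \<Rightarrow> 'a \<Rightarrow> 'a" where
  "nonlinear_pcg n M B f = pcg_u M B f n"

fun amli :: "('a::real_inner \<Rightarrow> 'a) \<Rightarrow> (nat \<Rightarrow> 'a set) \<Rightarrow> (nat \<Rightarrow> 'a \<Rightarrow> 'a) \<Rightarrow> nat \<Rightarrow> nat \<Rightarrow> 'a \<Rightarrow> 'a"
where
  "amli A V R n 0 = (\<lambda>f. 0)"
| "amli A V R n (Suc 0) = inv_into (V 1) (level_op A (V 1))"
| "amli A V R n (Suc (Suc k)) =
     cycle_step (V (Suc k)) (V (Suc (Suc k))) (level_op A (V (Suc (Suc k)))) (R (Suc (Suc k)))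
       (nonlinear_pcg n (level_op A (V (Suc k))) (amli A V R n (Suc k)))"

definition amli_pcg ::
  "('a::real_inner \<Rightarrow> 'a) \<Rightarrow> (nat \<Rightarrow> 'a set) \<Rightarrow> (nat \<Rightarrow> 'a \<Rightarrow> 'a) \<Rightarrow> nat \<Rightarrow> nat \<Rightarrow> 'a \<Rightarrow> 'a" where
  "amli_pcg A V R n k = nonlinear_pcg n (level_op A (V k)) (amli A V R n k)"

end

theory Submission
  imports Defs
begin

text \<open>Let \<open>E = I - R\<^sub>k A\<^sub>k\<close>, let \<open>w\<close> be the energy projection of \<open>E v\<close> onto \<open>V\<^sub>k\<^sub>-\<^sub>1\<close> and put
  \<open>d = E v - w\<close>. A cycle with coarse solver \<open>C\<close> has the error \<open>e = E\<^sup>* (d + x)\<close> with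
  \<open>x = w - C[A\<^sub>k\<^sub>-\<^sub>1 w]\<close>, and \<open>d\<close> is orthogonal to \<open>V\<^sub>k\<^sub>-\<^sub>1\<close>. Hence \<open>(e, v) = (d, d) + (x, w)\<close>, which
  reduces the comparison of two cycles to the comparison of their coarse solvers. Nonlinearity
  enters only through PCG. Its error \<open>x\<close> satisfies \<open>(x, w) = (x, x)\<close> by Galerkin orthogonality, so
  that \<open>(e, e) \<le> (d, d) + (x, x) = (e, v)\<close> for the AMLI error \<open>e\<close>, as \<open>E\<^sup>*\<close> is a contraction. Finally
  the PCG error minimises the energy norm over a space containing the preconditioned residual, so
  its pairing with \<open>v\<close>, being its squared norm, is at most \<open>(e, e)\<close>, hence at most \<open>(e, v)\<close>.\<close>

section \<open>The energy inner product: orthogonal bases, representation of functionals,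
  boundedness\<close>

locale energy_space =
  fixes A :: "'a::real_inner \<Rightarrow> 'a"
  assumes spd: "spd A"
    and finite_dim: "\<exists>B::'a set. finite B \<and> span B = UNIV"
begin

abbreviation a :: "'a \<Rightarrow> 'a \<Rightarrow> real" where
  "a \<equiv> a_inner A"

lemma linear_A: "linear A"
  using spd by (simp add: spd_def)

lemma a_commute: "a u v = a v u"
  using spd by (metis a_inner_def inner_commute spd_def)

lemma a_add_left: "a (u + w) v = a u v + a w v"
  and a_diff_left: "a (u - w) v = a u v - a w v"
  and a_scale_left: "a (c *\<^sub>R u) v = c * a u v"
  and a_sum_left: "a (sum f I) v = (\<Sum>i\<in>I. a (f i) v)"
  and a_zero_left: "a 0 v = 0"
  by (simp_all add: a_inner_def linear_A linear_add linear_diff linear_scale linear_sum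
      inner_add_left inner_diff_left inner_sum_left linear_0)

lemma a_add_right: "a u (v + w) = a u v + a u w"
  and a_diff_right: "a u (v - w) = a u v - a u w"
  and a_scale_right: "a u (c *\<^sub>R v) = c * a u v"
  and a_zero_right: "a u 0 = 0"
  by (simp_all add: a_inner_def inner_add_right inner_diff_right)

lemmas a_bilinear = a_add_left a_diff_left a_scale_left a_zero_left
  a_add_right a_diff_right a_scale_right a_zero_right

lemma a_nonneg: "0 \<le> a u u"
  using spd by (cases "u = 0") (auto simp: spd_def a_inner_def less_imp_le)

lemma a_eq_0_iff [simp]: "a u u = 0 \<longleftrightarrow> u = 0"
  using spd a_zero_left by (auto simp: spd_def a_inner_def)

text \<open>Orthogonality is in the energy product. The set \<open>C\<close> may contain
  \<open>0\<close>, since a dependent \<open>b\<close> contributes \<open>b - s = 0\<close>;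
  independence is never claimed.\<close>

lemma gram_schmidt:
  assumes "finite B"
  shows "\<exists>C. finite C \<and> span C = span B \<and> pairwise (\<lambda>x y. a x y = 0) C"
  using assms
proof (induction B rule: finite_induct)
  case empty
  then show ?case by (intro exI[of _ "{}"]) auto
next
  case (insert b B)
  then obtain C where C: "finite C" "span C = span B" "pairwise (\<lambda>x y. a x y = 0) C"
    by blast
  define s where "s = (\<Sum>c\<in>C. (a b c / a c c) *\<^sub>R c)"
  have s: "s \<in> span C"
    unfolding s_def by (intro span_sum span_scale span_base)
  have orth: "a (b - s) c = 0" if c: "c \<in> C" for c
  proof -
    \<comment> \<open>Only the term at \<open>c\<close> survives. If \<open>c = 0\<close>, both
      sides vanish, so dividing by \<open>a c c = 0\<close> is harmless.\<close>
    have "a s c = (\<Sum>c'\<in>C. if c' = c then a b c else 0)"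
      unfolding s_def a_sum_left
    proof (rule sum.cong)
      fix c' assume "c' \<in> C"
      then show "a ((a b c' / a c' c') *\<^sub>R c') c = (if c' = c then a b c else 0)"
        using C(3) c by (auto simp: a_scale_left pairwise_def a_zero_right)
    qed simp
    then show ?thesis
      using C(1) c by (simp add: a_diff_left)
  qed
  \<comment> \<open>As \<open>s\<close> lies in \<open>span C\<close>, replacing \<open>b\<close> by
    \<open>b - s\<close> does not change the span after insertion.\<close>
  have "x - t *\<^sub>R (b - s) \<in> span C \<longleftrightarrow> x - t *\<^sub>R b \<in> span C" for x t
  proof -
    have "x - t *\<^sub>R (b - s) = t *\<^sub>R s + (x - t *\<^sub>R b)"
      by (simp add: scaleR_right_diff_distrib)
    then show ?thesis
      using span_add_eq[OF span_scale[OF s, of t]] by metis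
  qed
  then have "span (insert (b - s) C) = span (insert b B)"
    unfolding set_eq_iff span_breakdown_eq C(2)[symmetric] by auto
  moreover have "pairwise (\<lambda>x y. a x y = 0) (insert (b - s) C)"
    using C(3) orth by (auto simp: pairwise_insert a_commute)
  ultimately show ?case
    using C(1) by blast
qed

lemma orthogonal_basis:
  assumes "subspace S"
  obtains C where "finite C" "span C = S" "pairwise (\<lambda>x y. a x y = 0) C"
proof -
  obtain B where B: "B \<subseteq> S" "independent B" "S \<subseteq> span B"
    by (rule maximal_independent_subset)
  obtain F where "finite F" "span F = (UNIV :: 'a set)"
    using finite_dim by blast
  then have "finite B"
    using independent_span_bound[of F B] B(2) by auto
  moreover have "span B = S"
    using B span_minimal[OF B(1) assms] by auto
  ultimately show ?thesis
    using gram_schmidt[of B] that by auto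
qed

text \<open>The representing vector is the Fourier sum over an orthogonal basis. Linearity of
  \<open>\<phi>\<close> is asked on \<open>S\<close> only, because operators on a level are
  unconstrained outside it.\<close>

lemma riesz:
  assumes S: "subspace S"
    and add: "\<And>u v. u \<in> S \<Longrightarrow> v \<in> S \<Longrightarrow> \<phi> (u + v) = \<phi> u + \<phi> v"
    and scale: "\<And>c u. u \<in> S \<Longrightarrow> \<phi> (c *\<^sub>R u) = c * \<phi> u"
  obtains w where "w \<in> S" "\<And>u. u \<in> S \<Longrightarrow> a w u = \<phi> u"
proof -
  obtain C where C: "finite C" "span C = S" "pairwise (\<lambda>x y. a x y = 0) C"
    using S by (rule orthogonal_basis)
  define w where "w = (\<Sum>c\<in>C. (\<phi> c / a c c) *\<^sub>R c)"
  \<comment> \<open>Covers a possible zero vector in \<open>C\<close>, whose coefficient is a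
    quotient by \<open>0\<close>.\<close>
  have phi0: "\<phi> 0 = 0"
    using scale[of 0 0] subspace_0[OF S] by simp
  have "w \<in> S"
    unfolding w_def C(2)[symmetric] by (intro span_sum span_scale span_base)
  moreover have "u \<in> S \<and> a w u = \<phi> u" if "u \<in> span C" for u
    using that
  proof (induction rule: span_induct)
    case base
    then show ?case
      using S add scale phi0 by (auto simp: subspace_def a_bilinear)
  next
    case (step c)
    have "a w c = (\<Sum>c'\<in>C. if c' = c then \<phi> c else 0)"
      unfolding w_def a_sum_left
    proof (rule sum.cong)
      fix c' assume "c' \<in> C"
      then show "a ((\<phi> c' / a c' c') *\<^sub>R c') c = (if c' = c then \<phi> c else 0)"
        using C(3) step phi0 by (auto simp: a_scale_left pairwise_def a_zero_right)
    qed simp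
    then show ?case
      using C step by (auto simp: span_base)
  qed
  ultimately show ?thesis
    using that C(2) by blast
qed

text \<open>Guarantees that the quotients in \<open>a_opnorm_on\<close> are bounded above; without
  this a supremum below \<open>1\<close> would say nothing about a single quotient. The bound is
  built up along an orthogonal basis, one direction at a time.\<close>

lemma linear_self_map_bounded:
  assumes S: "subspace S" and T: "linear_self_map_on S T"
  obtains K where "0 \<le> K" "\<And>u. u \<in> S \<Longrightarrow> a (T u) (T u) \<le> K * a u u"
proof -
  obtain C where C: "finite C" "span C = S" "pairwise (\<lambda>x y. a x y = 0) C"
    using S by (rule orthogonal_basis)
  have "\<exists>K\<ge>0. \<forall>u\<in>span D. a (T u) (T u) \<le> K * a u u" if "D \<subseteq> C" for D
    using finite_subset[OF that C(1)] that
  proof (induction D rule: finite_induct)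
    case empty
    have "T 0 = 0"
      using T subspace_0[OF S] unfolding linear_self_map_on_def by (metis scaleR_zero_left)
    then show ?case
      by (auto simp: a_zero_left)
  next
    case (insert c D)
    then obtain K where K: "0 \<le> K" "\<And>u. u \<in> span D \<Longrightarrow> a (T u) (T u) \<le> K * a u u"
      by auto
    show ?case
    proof (cases "c = 0")
      case True
      then show ?thesis
        using K by (auto simp: span_insert_0)
    next
      case False
      then have pos: "0 < a c c"
        using a_nonneg[of c] by (metis a_eq_0_iff less_le)
      \<comment> \<open>The factor \<open>2\<close> comes from bounding the squared norm of
        \<open>T y + t *\<^sub>R T c\<close> by twice the sum of the squared norms; orthogonality of
        \<open>y\<close> and \<open>c\<close> then allows the two summands to be bounded
        separately.\<close>
      define L where "L = 2 * K + 2 * a (T c) (T c) / a c c"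
      have "a (T u) (T u) \<le> L * a u u" if mem: "u \<in> span (insert c D)" for u
      proof -
        obtain t where y: "u - t *\<^sub>R c \<in> span D"
          using mem span_breakdown_eq by blast
        define y where "y = u - t *\<^sub>R c"
        have u: "u = y + t *\<^sub>R c"
          by (simp add: y_def)
        have "a y c = 0"
          using y[folded y_def]
        proof (induction rule: span_induct)
          case base
          show ?case by (auto simp: subspace_def a_bilinear)
        next
          case (step d)
          then show ?case
            using insert.prems insert.hyps C(3) by (auto simp: pairwise_def)
        qed
        then have uu: "a u u = a y y + t\<^sup>2 * a c c"
          by (simp add: u a_bilinear a_commute[of c y] power2_eq_square)
        have inS: "y \<in> S" "c \<in> S"
          using y insert.prems C(2) span_mono[of D C] by (auto simp: y_def span_base)
        then have Tu: "T u = T y + t *\<^sub>R T c"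
          using T S unfolding u linear_self_map_on_def by (simp add: subspace_scale)
        have "0 \<le> a (T y - t *\<^sub>R T c) (T y - t *\<^sub>R T c)"
          by (rule a_nonneg)
        then have "a (T u) (T u) \<le> 2 * a (T y) (T y) + 2 * t\<^sup>2 * a (T c) (T c)"
          by (simp add: Tu a_bilinear a_commute[of "T c" "T y"] power2_eq_square algebra_simps)
        also have "\<dots> \<le> 2 * (K * a y y) + 2 * t\<^sup>2 * a (T c) (T c)"
          using K(2) y by (simp add: y_def)
        also have "2 * t\<^sup>2 * a (T c) (T c) = (2 * a (T c) (T c) / a c c) * (t\<^sup>2 * a c c)"
          using False by simp
        also have "2 * (K * a y y) + \<dots> \<le> L * a u u"
          using K(1) pos a_nonneg[of y] a_nonneg[of "T c"]
          by (simp add: uu L_def distrib_left distrib_right)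
        finally show ?thesis .
      qed
      moreover have "0 \<le> L"
        using K(1) pos a_nonneg[of "T c"] by (simp add: L_def)
      ultimately show ?thesis by blast
    qed
  qed
  then show ?thesis
    using that C(2) by blast
qed

text \<open>Makes the results on \<open>a_inner\<close> available for the plain inner
  product.\<close>

lemma energy_space_id: "energy_space (\<lambda>x::'a. x)"
  using finite_dim by unfold_locales (auto simp: spd_def linear_ident)

text \<open>Unique existence is the form needed to resolve the definite descriptions in
  \<open>level_op\<close> and \<open>adjoint_on\<close>.\<close>

lemma inner_riesz:
  fixes S :: "'a set"
  assumes "subspace S"
    and "\<And>u v. u \<in> S \<Longrightarrow> v \<in> S \<Longrightarrow> \<phi> (u + v) = \<phi> u + \<phi> v"
    and "\<And>c u. u \<in> S \<Longrightarrow> \<phi> (c *\<^sub>R u) = c * \<phi> u"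
  shows "\<exists>!w. w \<in> S \<and> (\<forall>u\<in>S. w \<bullet> u = \<phi> u)"
proof -
  obtain w where w: "w \<in> S" "\<And>u. u \<in> S \<Longrightarrow> w \<bullet> u = \<phi> u"
    by (rule energy_space.riesz[OF energy_space_id assms(1), of \<phi>])
      (use assms in \<open>auto simp: a_inner_def\<close>)
  moreover have "w' = w" if "w' \<in> S" "\<And>u. u \<in> S \<Longrightarrow> w' \<bullet> u = \<phi> u" for w'
  proof -
    have "(w' - w) \<bullet> (w' - w) = 0"
      using that w subspace_diff[OF assms(1)] by (simp add: inner_diff_left)
    then show ?thesis by simp
  qed
  ultimately show ?thesis by blast
qed

end

section \<open>The level operator, projections, adjoints and the operator norm on one
  subspace\<close>

locale level = energy_space +
  fixes S :: "'a set"
  assumes subspace_S: "subspace S"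
begin

abbreviation M :: "'a \<Rightarrow> 'a" where
  "M \<equiv> level_op A S"

lemma level_op_mem [simp]: "M u \<in> S"
  and level_op_inner: "v \<in> S \<Longrightarrow> M u \<bullet> v = a u v"
proof -
  have "\<exists>!w. w \<in> S \<and> (\<forall>v\<in>S. w \<bullet> v = a u v)" for u
    by (rule inner_riesz[OF subspace_S]) (simp_all add: a_bilinear)
  from theI'[OF this[of u]] show "M u \<in> S" "v \<in> S \<Longrightarrow> M u \<bullet> v = a u v"
    by (auto simp: level_op_def)
qed

lemma a_level_op: "v \<in> S \<Longrightarrow> a_inner M u v = a u v"
  by (simp add: a_inner_def level_op_inner)

lemma eq_if_inner_eq:
  assumes "x \<in> S" "y \<in> S" "\<And>v. v \<in> S \<Longrightarrow> x \<bullet> v = y \<bullet> v"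
  shows "x = y"
proof -
  have "(x - y) \<bullet> (x - y) = 0"
    using assms subspace_diff[OF subspace_S] by (simp add: inner_diff_left)
  then show ?thesis by simp
qed

lemma linear_level_op: "linear M"
proof (rule linearI)
  fix x y c
  show "M (x + y) = M x + M y"
    by (rule eq_if_inner_eq)
      (simp_all add: subspace_add[OF subspace_S] level_op_inner a_bilinear inner_add_left)
  show "M (c *\<^sub>R x) = c *\<^sub>R M x"
    by (rule eq_if_inner_eq)
      (simp_all add: subspace_scale[OF subspace_S] level_op_inner a_bilinear)
qed

lemma inj_on_level_op: "inj_on M S"
proof (rule inj_onI)
  fix x y assume *: "x \<in> S" "y \<in> S" "M x = M y"
  then have d: "x - y \<in> S"
    by (simp add: subspace_diff[OF subspace_S])
  have "M (x - y) = 0"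
    using * by (simp add: linear_diff[OF linear_level_op])
  then have "a (x - y) (x - y) = 0"
    using level_op_inner[OF d, of "x - y"] by simp
  then show "x = y" by simp
qed

lemma energy_proj_exists:
  obtains w where "w \<in> S" "\<And>u. u \<in> S \<Longrightarrow> a (x - w) u = 0"
proof -
  obtain w where "w \<in> S" "\<And>u. u \<in> S \<Longrightarrow> a w u = a x u"
    by (rule riesz[OF subspace_S, of "a x"]) (auto simp: a_bilinear)
  then show ?thesis
    using that by (simp add: a_diff_left)
qed

lemma orth_proj_eqI:
  assumes "y \<in> S" "\<And>w. w \<in> S \<Longrightarrow> (x - y) \<bullet> w = 0"
  shows "orth_proj S x = y"
  unfolding orth_proj_def
proof (rule the_equality)
  fix z assume z: "z \<in> S \<and> (\<forall>w\<in>S. (x - z) \<bullet> w = 0)"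
  show "z = y"
    using z assms by (intro eq_if_inner_eq) (auto simp: inner_diff_left)
qed (use assms in auto)

lemma adjoint_on_spec:
  assumes "linear_self_map_on S T"
  shows "adjoint_on S T v \<in> S \<and> (\<forall>u\<in>S. T u \<bullet> v = u \<bullet> adjoint_on S T v)"
proof -
  have "\<exists>!w. w \<in> S \<and> (\<forall>u\<in>S. w \<bullet> u = T u \<bullet> v)"
    using assms
    by (intro inner_riesz[OF subspace_S]) (auto simp: linear_self_map_on_def inner_add_left)
  moreover have "w \<bullet> u = T u \<bullet> v \<longleftrightarrow> T u \<bullet> v = u \<bullet> w" for w u
    by (metis inner_commute)
  ultimately have "\<exists>!w. w \<in> S \<and> (\<forall>u\<in>S. T u \<bullet> v = u \<bullet> w)"
    by simp
  from theI'[OF this] show ?thesis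
    unfolding adjoint_on_def .
qed

text \<open>Each quotient is at most the supremum, which is finite by
  \<open>linear_self_map_bounded\<close>. The weak inequality also covers
  \<open>u = 0\<close>.\<close>

lemma contraction_if_opnorm_less_1:
  assumes T: "linear_self_map_on S T" and less: "a_opnorm_on S M T < 1" and u: "u \<in> S"
  shows "a (T u) (T u) \<le> a u u"
proof (cases "u = 0")
  case True
  then have "T u = 0"
    using T u unfolding linear_self_map_on_def by (metis scaleR_zero_left)
  then show ?thesis
    using a_nonneg by (simp add: a_zero_left)
next
  case False
  have norm: "a_norm M x = sqrt (a x x)" if "x \<in> S" for x
    using that by (simp add: a_norm_def a_level_op)
  have TS: "T x \<in> S" if "x \<in> S" for x
    using T that by (auto simp: linear_self_map_on_def)
  obtain K where K: "0 \<le> K" "\<And>u. u \<in> S \<Longrightarrow> a (T u) (T u) \<le> K * a u u"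
    using linear_self_map_bounded[OF subspace_S T] by blast
  have "a_norm M (T x) / a_norm M x \<le> sqrt K" if x: "x \<in> S" for x
  proof (cases "x = 0")
    case True
    then show ?thesis
      using K(1) norm[OF x] by (simp add: a_zero_left)
  next
    case False
    then have "0 < a x x"
      using a_nonneg[of x] by (metis a_eq_0_iff less_le)
    then show ?thesis
      using K(2)[OF x] by (simp add: norm x TS real_sqrt_divide[symmetric] divide_le_eq)
  qed
  then have "bdd_above ((\<lambda>u. a_norm M (T u) / a_norm M u) ` S)"
    by (auto intro!: bdd_aboveI)
  from cSUP_upper[OF u this] have "a_norm M (T u) / a_norm M u < 1"
    using less by (simp add: a_opnorm_on_def)
  moreover have "0 < a u u"
    using False a_nonneg[of u] by (metis a_eq_0_iff less_le)
  ultimately show ?thesis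
    by (simp add: norm u TS real_sqrt_divide[symmetric])
qed

section \<open>Nonlinear PCG on one level\<close>

lemma pcg_mem:
  assumes B: "B ` S \<subseteq> S" and f: "f \<in> S"
  shows "pcg_r M B f i \<in> S \<and> pcg_p M B f i \<in> S"
proof (induction i rule: less_induct)
  case (less i)
  have r: "pcg_r M B f i \<in> S"
  proof (cases i)
    case 0
    then show ?thesis using f by simp
  next
    case (Suc i')
    then show ?thesis
      using less[of i'] by (simp add: subspace_diff subspace_scale subspace_S)
  qed
  moreover have "pcg_p M B f i \<in> S"
    using r B less unfolding pcg_p.simps[of M B f i]
    by (intro subspace_add subspace_sum subspace_scale subspace_S) auto
  ultimately show ?case by blast
qed

lemma pcg_u_mem:
  assumes "B ` S \<subseteq> S" "f \<in> S"
  shows "pcg_u M B f i \<in> S"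
  by (induction i)
    (auto simp: subspace_0 subspace_add subspace_scale subspace_S pcg_mem[OF assms])

text \<open>The residual and iterate recurrences use the same step, and \<open>M\<close> is linear;
  so residual pairings become energy pairings of the error.\<close>

lemma pcg_r_eq: "pcg_r M B (M v) i = M (v - pcg_u M B (M v) i)"
  by (induction i)
    (simp_all add: linear_diff[OF linear_level_op] linear_add[OF linear_level_op]
      linear_scale[OF linear_level_op])

text \<open>Full orthogonalisation: the earlier directions are conjugate by induction, so pairing
  with \<open>p j\<close> leaves only the \<open>j\<close>-th correction, which cancels the
  contribution of \<open>z\<close>. Nothing is assumed about \<open>B\<close> beyond mapping
  \<open>S\<close> to itself.\<close>

lemma pcg_p_orthogonal:
  assumes "B ` S \<subseteq> S" "f \<in> S"
  shows "j < i \<Longrightarrow> a (pcg_p M B f i) (pcg_p M B f j) = 0"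
proof (induction i arbitrary: j rule: less_induct)
  case (less i)
  define p where "p = pcg_p M B f"
  define z where "z = B (pcg_r M B f i)"
  have IH: "a (p l) (p j) = 0" if "l < i" "l \<noteq> j" for l
    using less.IH[of l j] less.IH[of j l] less.prems that
    by (cases l j rule: linorder_cases) (auto simp: p_def a_commute)
  have "p i = z + (\<Sum>l<i. (- a z (p l) / a (p l) (p l)) *\<^sub>R p l)"
    unfolding p_def z_def pcg_p.simps[of M B f i]
    by (simp add: a_level_op pcg_mem[OF assms])
  then have "a (p i) (p j) = a z (p j) + (\<Sum>l<i. (- a z (p l) / a (p l) (p l)) * a (p l) (p j))"
    by (simp only: a_add_left a_sum_left a_scale_left)
  also have "(\<Sum>l<i. (- a z (p l) / a (p l) (p l)) * a (p l) (p j))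
      = (\<Sum>l<i. if l = j then - a z (p j) else 0)"
    \<comment> \<open>For \<open>l = j\<close> the denominator cancels, and if
      \<open>p j = 0\<close> both sides are \<open>0\<close>.\<close>
    using IH by (intro sum.cong) (auto simp: a_zero_right)
  finally show ?case
    using less.prems by (simp add: p_def)
qed

text \<open>The step along \<open>p i\<close> removes the error component in that direction, and
  conjugacy keeps the orthogonality to earlier directions.\<close>

lemma pcg_error_orthogonal:
  assumes B: "B ` S \<subseteq> S"
  shows "j < i \<Longrightarrow> a (v - pcg_u M B (M v) i) (pcg_p M B (M v) j) = 0"
proof (induction i)
  case (Suc i)
  define p where "p = pcg_p M B (M v)"
  define e where "e = v - pcg_u M B (M v) i"
  have p: "p l \<in> S" for l
    using pcg_mem[OF B] by (simp add: p_def)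
  have "v - pcg_u M B (M v) (Suc i) = e - (a e (p i) / a (p i) (p i)) *\<^sub>R p i"
    using p[of i] by (simp add: e_def p_def pcg_r_eq level_op_inner a_level_op)
  then have eq: "a (v - pcg_u M B (M v) (Suc i)) (p j)
      = a e (p j) - a e (p i) / a (p i) (p i) * a (p i) (p j)"
    by (simp add: a_diff_left a_scale_left)
  show ?case
  proof (cases "j = i")
    case True
    then show ?thesis
      \<comment> \<open>A vanishing direction gives the default coefficient \<open>0\<close>, but
        pairing with \<open>0\<close> is trivial anyway.\<close>
      unfolding p_def[symmetric] eq by (cases "p i = 0") (auto simp: a_zero_right)
  next
    case False
    then have "j < i"
      using Suc.prems by simp
    then show ?thesis
      unfolding p_def[symmetric] eq
      using Suc.IH pcg_p_orthogonal[OF B level_op_mem, of j i v] by (simp add: e_def p_def)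
  qed
qed simp

lemma pcg_u_orthogonal:
  assumes "\<And>j. j < i \<Longrightarrow> a x (pcg_p M B f j) = 0"
  shows "a x (pcg_u M B f i) = 0"
  using assms by (induction i) (auto simp: a_bilinear)

text \<open>The first search direction is \<open>B f\<close> itself, so \<open>B f\<close> is one of the competitors among which
  the PCG iterate minimises the energy norm of the error.\<close>

lemma nonlinear_pcg_error:
  fixes v :: 'a
  assumes B: "B ` S \<subseteq> S" and n: "1 \<le> n"
  defines "e \<equiv> v - nonlinear_pcg n M B (M v)"
  shows "a e v = a e e"
    and "a e e \<le> a (v - B (M v)) (v - B (M v))"
proof -
  define u where "u = nonlinear_pcg n M B (M v)"
  have orth: "a e (pcg_p M B (M v) j) = 0" if "j < n" for j
    using pcg_error_orthogonal[OF B that] by (simp add: e_def nonlinear_pcg_def)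
  have eu: "a e u = 0"
    using pcg_u_orthogonal[OF orth] by (simp add: u_def nonlinear_pcg_def)
  then show "a e v = a e e"
    by (simp add: e_def u_def a_diff_right)
  define d where "d = u - B (M v)"
  have "pcg_p M B (M v) 0 = B (M v)"
    by (simp add: pcg_p.simps[of M B "M v" 0])
  \<comment> \<open>Since \<open>n\<close> is at least \<open>1\<close>, direction \<open>0\<close>
    is among those to which \<open>e\<close> is orthogonal.\<close>
  then have "a e d = 0"
    using eu orth[of 0] n by (simp add: d_def a_diff_right)
  moreover have "v - B (M v) = e + d"
    by (simp add: e_def d_def u_def)
  ultimately show "a e e \<le> a (v - B (M v)) (v - B (M v))"
    using a_nonneg[of d] by (simp add: a_bilinear a_commute[of d e])
qed

lemma nonlinear_pcg_mem:
  assumes "B ` S \<subseteq> S"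
  shows "nonlinear_pcg n M B ` S \<subseteq> S"
  using pcg_u_mem[OF assms] by (auto simp: nonlinear_pcg_def)

end

section \<open>Error propagation of one symmetric two-level step\<close>

locale two_level = level +
  fixes S' :: "'a set" and R :: "'a \<Rightarrow> 'a"
  assumes subspace_S': "subspace S'"
    and nested: "S' \<subseteq> S"
    and R_linear: "linear_self_map_on S R"
    and R_convergent: "a_opnorm_on S M (\<lambda>u. u - R (M u)) < 1"
begin

sublocale coarse: level A S'
  by unfold_locales (rule subspace_S')

abbreviation M' :: "'a \<Rightarrow> 'a" where
  "M' \<equiv> level_op A S'"

definition smooth :: "'a \<Rightarrow> 'a" where
  "smooth u = u - R (M u)"

definition smooth_adj :: "'a \<Rightarrow> 'a" where
  "smooth_adj u = u - adjoint_on S R (M u)"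

lemma R_mem: "u \<in> S \<Longrightarrow> R u \<in> S"
  using R_linear by (auto simp: linear_self_map_on_def)

lemma smooth_mem: "u \<in> S \<Longrightarrow> smooth u \<in> S"
  by (simp add: smooth_def R_mem subspace_diff subspace_S)

lemma smooth_adj_mem: "u \<in> S \<Longrightarrow> smooth_adj u \<in> S"
  using adjoint_on_spec[OF R_linear] by (simp add: smooth_adj_def subspace_diff subspace_S)

lemma smooth_linear: "linear_self_map_on S smooth"
  unfolding linear_self_map_on_def
proof (intro conjI ballI allI)
  show "smooth ` S \<subseteq> S"
    using smooth_mem by blast
  show "smooth (u + v) = smooth u + smooth v" for u v
    using R_linear by (simp add: smooth_def linear_add[OF linear_level_op] linear_self_map_on_def)
  show "smooth (c *\<^sub>R u) = c *\<^sub>R smooth u" for c u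
    using R_linear
    by (simp add: smooth_def linear_scale[OF linear_level_op] linear_self_map_on_def
        scaleR_right_diff_distrib)
qed

lemma smooth_contraction: "u \<in> S \<Longrightarrow> a (smooth u) (smooth u) \<le> a u u"
  using contraction_if_opnorm_less_1[OF smooth_linear] R_convergent
  by (simp add: smooth_def[abs_def])

text \<open>\<open>adjoint_on\<close> refers to the plain inner product, yet post-smoothing is the
  energy adjoint of pre-smoothing: \<open>M\<close> converts energy pairings into plain ones on both
  sides of \<open>R\<close>.\<close>

lemma smooth_adj:
  assumes "v \<in> S"
  shows "a (smooth_adj u) v = a u (smooth v)"
proof -
  define w where "w = adjoint_on S R (M u)"
  have w: "w \<in> S" "\<And>x. x \<in> S \<Longrightarrow> R x \<bullet> M u = x \<bullet> w"
    using adjoint_on_spec[OF R_linear] by (auto simp: w_def)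
  have "a w v = M v \<bullet> w"
    using w(1) by (simp add: a_commute[of w v] level_op_inner)
  also have "\<dots> = M u \<bullet> R (M v)"
    using w(2)[OF level_op_mem, of v] by (simp add: inner_commute)
  also have "\<dots> = a u (R (M v))"
    by (simp add: level_op_inner R_mem)
  finally show ?thesis
    by (simp add: smooth_adj_def smooth_def a_bilinear w_def)
qed

text \<open>An adjoint of a contraction is a contraction, here without operator norms: with
  \<open>x = smooth_adj u\<close> and \<open>y = smooth x\<close>, expanding
  \<open>a (u - y) (u - y)\<close> and using \<open>a u y = a x x\<close> and
  \<open>a y y \<le> a x x\<close> gives the bound.\<close>

lemma smooth_adj_contraction:
  assumes "u \<in> S"
  shows "a (smooth_adj u) (smooth_adj u) \<le> a u u"
proof -
  define x y where "x = smooth_adj u" and "y = smooth x"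
  have x: "x \<in> S"
    using assms by (simp add: x_def smooth_adj_mem)
  have "a u y = a x x"
    using smooth_adj[OF x, of u] by (simp add: x_def y_def)
  moreover have "a y y \<le> a x x"
    using smooth_contraction[OF x] by (simp add: y_def)
  moreover have "0 \<le> a (u - y) (u - y)"
    by (rule a_nonneg)
  ultimately show ?thesis
    by (simp add: x_def a_bilinear a_commute[of y u])
qed

text \<open>The hypotheses make \<open>w\<close> the energy projection of \<open>smooth v\<close>
  onto \<open>S'\<close>. The plain projection of the residual \<open>M (smooth v)\<close> is then
  \<open>M' w\<close>, so the coarse solver receives the coarse equation with exact solution
  \<open>w\<close>.\<close>

lemma cycle_step_error:
  assumes w: "w \<in> S'" "\<And>u. u \<in> S' \<Longrightarrow> a (smooth v - w) u = 0"
  shows "v - cycle_step S' S M R C (M v) = smooth_adj (smooth v - C (M' w))"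
proof -
  have "orth_proj S' (M v - M (R (M v))) = M' w"
  proof (rule coarse.orth_proj_eqI)
    fix u assume u: "u \<in> S'"
    then have "(M (smooth v) - M' w) \<bullet> u = a (smooth v - w) u"
      using nested
      by (auto simp: inner_diff_left level_op_inner coarse.level_op_inner a_diff_left)
    then show "(M v - M (R (M v)) - M' w) \<bullet> u = 0"
      using w(2)[OF u] by (simp add: smooth_def linear_diff[OF linear_level_op])
  qed simp
  moreover have "M v - M (R (M v) + C (M' w)) = M (smooth v - C (M' w))"
    by (simp add: smooth_def linear_diff[OF linear_level_op] linear_add[OF linear_level_op])
  ultimately show ?thesis
    by (simp add: cycle_step_def Let_def smooth_adj_def) (simp add: smooth_def)
qed

lemma cycle_step_mem:
  assumes "C ` S' \<subseteq> S'"
  shows "cycle_step S' S M R C ` S \<subseteq> S"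
proof -
  have "orth_proj S' x \<in> S'" for x
  proof -
    obtain y where "y \<in> S'" "\<And>u. u \<in> S' \<Longrightarrow> y \<bullet> u = x \<bullet> u"
      using inner_riesz[OF subspace_S', of "\<lambda>u. x \<bullet> u"] by (auto simp: inner_add_right)
    then show ?thesis
      using coarse.orth_proj_eqI[of y x] by (simp add: inner_diff_left)
  qed
  then have "C (orth_proj S' x) \<in> S" for x
    using assms nested by blast
  then show ?thesis
    using adjoint_on_spec[OF R_linear] R_mem
    by (auto simp: cycle_step_def Let_def intro!: subspace_add[OF subspace_S])
qed

text \<open>With \<open>w\<close> the energy projection of the pre-smoothed error \<open>smooth v\<close> onto the coarse space, the
  energy pairing of the cycle error with \<open>v\<close> splits into a part that does not depend on the
  coarse solver and the same pairing one level below.\<close>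

lemma cycle_step_energy:
  assumes v: "v \<in> S"
  obtains w c where "w \<in> S'" "0 \<le> c"
    and "\<And>C. C ` S' \<subseteq> S' \<Longrightarrow>
      a (v - cycle_step S' S M R C (M v)) v = c + a (w - C (M' w)) w"
    and "\<And>C. C ` S' \<subseteq> S' \<Longrightarrow>
      a (v - cycle_step S' S M R C (M v)) (v - cycle_step S' S M R C (M v))
        \<le> c + a (w - C (M' w)) (w - C (M' w))"
proof -
  obtain w where w: "w \<in> S'" "\<And>u. u \<in> S' \<Longrightarrow> a (smooth v - w) u = 0"
    using coarse.energy_proj_exists by blast
  define d where "d = smooth v - w"
  have d: "a d u = 0" "a u d = 0" if "u \<in> S'" for u
    using w(2)[OF that] by (auto simp: d_def a_commute[of u])
  have sv: "smooth v = d + w"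
    by (simp add: d_def)
  show ?thesis
  \<comment> \<open>Both \<open>w\<close> and the constant are fixed before \<open>C\<close>, so two
    cycles can be compared with the same data.\<close>
  proof (rule that[of w "a d d"])
    fix C assume C: "C ` S' \<subseteq> S'"
    define x where "x = w - C (M' w)"
    have x: "x \<in> S'"
      using C w(1) by (auto simp: x_def intro!: subspace_diff[OF subspace_S'])
    have err: "v - cycle_step S' S M R C (M v) = smooth_adj (d + x)"
      using cycle_step_error[OF w, of C] by (simp add: d_def x_def)
    \<comment> \<open>After moving the adjoint onto \<open>v\<close>, the pairing is that of
      \<open>d + x\<close> with \<open>d + w\<close>; the mixed terms vanish as \<open>x\<close> and
      \<open>w\<close> are coarse.\<close>
    have "a (smooth_adj (d + x)) v = a d d + a x w"
      using d[OF w(1)] d[OF x] by (simp add: smooth_adj[OF v] sv a_bilinear)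
    then show "a (v - cycle_step S' S M R C (M v)) v = a d d + a (w - C (M' w)) w"
      by (simp add: err x_def)
    have "d + x \<in> S"
      using x w(1) nested smooth_mem[OF v]
      by (auto simp: d_def intro!: subspace_add[OF subspace_S] subspace_diff[OF subspace_S])
    then have "a (smooth_adj (d + x)) (smooth_adj (d + x)) \<le> a d d + a x x"
      using smooth_adj_contraction[of "d + x"] d[OF x] by (simp add: a_bilinear)
    then show "a (v - cycle_step S' S M R C (M v)) (v - cycle_step S' S M R C (M v))
        \<le> a d d + a (w - C (M' w)) (w - C (M' w))"
      by (simp add: err x_def)
  qed (use w(1) a_nonneg in auto)
qed

end

section \<open>Comparison of the cycles by induction over the levels\<close>

locale multigrid = energy_space +
  fixes V :: "nat \<Rightarrow> 'a set" and R :: "nat \<Rightarrow> 'a \<Rightarrow> 'a" and J n :: nat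
  assumes V_subspace: "\<And>i. 1 \<le> i \<Longrightarrow> i \<le> J \<Longrightarrow> subspace (V i)"
    and V_nested: "\<And>i. 1 \<le> i \<Longrightarrow> i < J \<Longrightarrow> V i \<subseteq> V (Suc i)"
    and R_linear: "\<And>i. 2 \<le> i \<Longrightarrow> i \<le> J \<Longrightarrow> linear_self_map_on (V i) (R i)"
    and R_convergent: "\<And>i. 2 \<le> i \<Longrightarrow> i \<le> J \<Longrightarrow>
      a_opnorm_on (V i) (level_op A (V i)) (\<lambda>u. u - R i (level_op A (V i) u)) < 1"
    and n: "1 \<le> n"
begin

abbreviation L :: "nat \<Rightarrow> 'a \<Rightarrow> 'a" where
  "L k \<equiv> level_op A (V k)"

abbreviation amli_error :: "nat \<Rightarrow> 'a \<Rightarrow> 'a" where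
  "amli_error k v \<equiv> v - amli A V R n k (L k v)"

abbreviation amli_pcg_error :: "nat \<Rightarrow> 'a \<Rightarrow> 'a" where
  "amli_pcg_error k v \<equiv> v - amli_pcg A V R n k (L k v)"

abbreviation vcycle_error :: "nat \<Rightarrow> 'a \<Rightarrow> 'a" where
  "vcycle_error k v \<equiv> v - vcycle A V R k (L k v)"

lemma level: "1 \<le> k \<Longrightarrow> k \<le> J \<Longrightarrow> level A (V k)"
  by unfold_locales (rule V_subspace)

lemma two_level:
  "Suc (Suc k) \<le> J \<Longrightarrow> two_level A (V (Suc (Suc k))) (V (Suc k)) (R (Suc (Suc k)))"
  by unfold_locales (auto intro: V_subspace R_linear R_convergent set_mp[OF V_nested])

text \<open>On level \<open>1\<close> the operator is a bijection of \<open>V 1\<close>, so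
  \<open>inv_into\<close> is a genuine inverse and both cycles start from an exact solve.\<close>

lemma coarsest_solve:
  assumes "1 \<le> J"
  shows "f \<in> V 1 \<Longrightarrow> inv_into (V 1) (L 1) f \<in> V 1"
    and "v \<in> V 1 \<Longrightarrow> inv_into (V 1) (L 1) (L 1 v) = v"
proof -
  interpret level A "V 1"
    using level assms by simp
  show "v \<in> V 1 \<Longrightarrow> inv_into (V 1) (L 1) (L 1 v) = v"
    by (rule inv_into_f_f[OF inj_on_level_op])
  show "inv_into (V 1) (L 1) f \<in> V 1" if f: "f \<in> V 1"
  proof -
    obtain w where w: "w \<in> V 1" "\<And>u. u \<in> V 1 \<Longrightarrow> a w u = f \<bullet> u"
      by (rule riesz[OF subspace_S, of "\<lambda>u. f \<bullet> u"]) (auto simp: inner_add_right)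
    have "L 1 w = f"
      using f w by (intro eq_if_inner_eq) (auto simp: level_op_inner simp del: One_nat_def)
    then show ?thesis
      using w(1) by (metis image_eqI inv_into_into)
  qed
qed

lemma vcycle_mem: "1 \<le> k \<Longrightarrow> k \<le> J \<Longrightarrow> vcycle A V R k ` V k \<subseteq> V k"
proof (induction k rule: nat_induct_at_least)
  case base
  then show ?case
    using coarsest_solve(1) by auto
next
  case (Suc k)
  then obtain k' where k: "k = Suc k'"
    by (cases k) auto
  show ?case
    using two_level.cycle_step_mem[OF two_level, of k'] Suc by (simp add: k)
qed

lemma amli_mem: "1 \<le> k \<Longrightarrow> k \<le> J \<Longrightarrow> amli A V R n k ` V k \<subseteq> V k"
proof (induction k rule: nat_induct_at_least)
  case base
  then show ?case
    using coarsest_solve(1) by auto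
next
  case (Suc k)
  then obtain k' where k: "k = Suc k'"
    by (cases k) auto
  show ?case
    using two_level.cycle_step_mem[OF two_level, of k'] level.nonlinear_pcg_mem[OF level[of k]] Suc
    by (simp add: k)
qed

lemma amli_pcg_mem: "1 \<le> k \<Longrightarrow> k \<le> J \<Longrightarrow> amli_pcg A V R n k ` V k \<subseteq> V k"
  unfolding amli_pcg_def by (intro level.nonlinear_pcg_mem level amli_mem)

lemma amli_pcg_error:
  assumes "1 \<le> k" "k \<le> J"
  shows "a (amli_pcg_error k v) v = a (amli_pcg_error k v) (amli_pcg_error k v)"
    and "a (amli_pcg_error k v) (amli_pcg_error k v) \<le> a (amli_error k v) (amli_error k v)"
  unfolding amli_pcg_def
  using level.nonlinear_pcg_error[OF level amli_mem n] assms by auto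

text \<open>The two inequalities are coupled: the second one on level \<open>Suc k\<close> uses both
  on level \<open>k\<close>. The vector is kept general because the hypothesis is applied to the
  projected error \<open>w\<close>.\<close>

lemma amli_error:
  "1 \<le> k \<Longrightarrow> k \<le> J \<Longrightarrow> v \<in> V k \<Longrightarrow>
     a (amli_error k v) (amli_error k v) \<le> a (amli_error k v) v
   \<and> a (amli_error k v) v \<le> a (vcycle_error k v) v"
proof (induction k arbitrary: v rule: nat_induct_at_least)
  case base
  then show ?case
    using coarsest_solve(2)[of v] by (simp add: a_zero_left)
next
  case (Suc k)
  \<comment> \<open>The recursive cycle equations start at \<open>Suc (Suc k')\<close>, so
    \<open>k\<close> is written as a successor.\<close>
  then obtain k' where k: "k = Suc k'"
    by (cases k) auto
  have kJ: "k \<le> J"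
    using Suc.prems by simp
  interpret two_level A "V (Suc k)" "V k" "R (Suc k)"
    using two_level Suc.prems by (simp add: k)
  have amli: "amli A V R n (Suc k) = cycle_step (V k) (V (Suc k)) (level_op A (V (Suc k)))
      (R (Suc k)) (amli_pcg A V R n k)"
    by (simp add: k amli_pcg_def)
  have vcycle: "vcycle A V R (Suc k) = cycle_step (V k) (V (Suc k)) (level_op A (V (Suc k)))
      (R (Suc k)) (vcycle A V R k)"
    by (simp add: k)
  obtain w c where w: "w \<in> V k" and c: "0 \<le> c"
    and pairing: "\<And>C. C ` V k \<subseteq> V k \<Longrightarrow>
      a (v - cycle_step (V k) (V (Suc k)) (level_op A (V (Suc k))) (R (Suc k)) C
        (level_op A (V (Suc k)) v)) v = c + a (w - C (level_op A (V k) w)) w"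
    and norm: "\<And>C. C ` V k \<subseteq> V k \<Longrightarrow>
      a (v - cycle_step (V k) (V (Suc k)) (level_op A (V (Suc k))) (R (Suc k)) C
          (level_op A (V (Suc k)) v))
        (v - cycle_step (V k) (V (Suc k)) (level_op A (V (Suc k))) (R (Suc k)) C
          (level_op A (V (Suc k)) v))
      \<le> c + a (w - C (level_op A (V k) w)) (w - C (level_op A (V k) w))"
    using cycle_step_energy[OF Suc.prems(2)] by blast
  have amli_pairing: "a (amli_error (Suc k) v) v = c + a (amli_pcg_error k w) w"
    using pairing[OF amli_pcg_mem[OF Suc.hyps kJ]] by (simp only: amli)
  have "a (amli_error (Suc k) v) (amli_error (Suc k) v)
      \<le> c + a (amli_pcg_error k w) (amli_pcg_error k w)"
    using norm[OF amli_pcg_mem[OF Suc.hyps kJ]] by (simp only: amli)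
  \<comment> \<open>Galerkin orthogonality of PCG turns the squared norm of the coarse error into
    its pairing with \<open>w\<close>.\<close>
  also have "\<dots> = a (amli_error (Suc k) v) v"
    using amli_pcg_error(1)[OF Suc.hyps kJ] amli_pairing by simp
  finally have "a (amli_error (Suc k) v) (amli_error (Suc k) v) \<le> a (amli_error (Suc k) v) v" .
  \<comment> \<open>On level \<open>k\<close>, the PCG pairing is a squared norm, at most the
    squared norm of the AMLI error, hence at most the AMLI pairing and then the V-cycle
    pairing.\<close>
  moreover have "a (amli_error (Suc k) v) v \<le> c + a (vcycle_error k w) w"
    using amli_pairing amli_pcg_error[OF Suc.hyps kJ, of w] Suc.IH[OF kJ w] by simp
  moreover have "c + a (vcycle_error k w) w = a (vcycle_error (Suc k) v) v"
    using pairing[OF vcycle_mem[OF Suc.hyps kJ]] by (simp only: vcycle)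
  ultimately show ?case by simp
qed

end

theorem theorem3p6:
  fixes A :: "'a::real_inner \<Rightarrow> 'a"
    and V :: "nat \<Rightarrow> 'a set"
    and R :: "nat \<Rightarrow> 'a \<Rightarrow> 'a"
    and J n k :: nat
    and v :: 'a
  assumes finite_dim: "\<exists>B::'a set. finite B \<and> span B = UNIV"
    and A_spd: "spd A"
    and J: "1 \<le> J"
    and V_subspace: "\<And>i. 1 \<le> i \<Longrightarrow> i \<le> J \<Longrightarrow> subspace (V i)"
    and V_nested: "\<And>i. 1 \<le> i \<Longrightarrow> i < J \<Longrightarrow> V i \<subseteq> V (Suc i)"
    and V_top: "V J = UNIV"
    and R_linear: "\<And>i. 2 \<le> i \<Longrightarrow> i \<le> J \<Longrightarrow> linear_self_map_on (V i) (R i)"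
    and R_convergent: "\<And>i. 2 \<le> i \<Longrightarrow> i \<le> J \<Longrightarrow>
      a_opnorm_on (V i) (level_op A (V i)) (\<lambda>u. u - R i (level_op A (V i) u)) < 1"
    and n: "1 \<le> n"
    and k: "1 \<le> k" "k \<le> J"
    and v: "v \<in> V k"
  shows "0 \<le> a_inner (level_op A (V k)) (v - amli_pcg A V R n k (level_op A (V k) v)) v
    \<and> a_inner (level_op A (V k)) (v - amli_pcg A V R n k (level_op A (V k) v)) v
        \<le> a_inner (level_op A (V k)) (v - amli A V R n k (level_op A (V k) v)) v
    \<and> a_inner (level_op A (V k)) (v - amli A V R n k (level_op A (V k) v)) v
        \<le> a_inner (level_op A (V k)) (v - vcycle A V R k (level_op A (V k) v)) v"
proof -
  interpret multigrid A V R J n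
    by unfold_locales (fact A_spd finite_dim V_subspace V_nested R_linear R_convergent n)+
  interpret level A "V k"
    using level k by simp
  show ?thesis
    \<comment> \<open>All pairings have \<open>v\<close> in \<open>V k\<close> as second argument,
      so each is a pairing in the global energy product.\<close>
    unfolding a_level_op[OF v]
    using amli_pcg_error[OF k, of v] amli_error[OF k v]
      a_nonneg[of "v - amli_pcg A V R n k (level_op A (V k) v)"]
    by simp
qed

end
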